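(* There exists a pair of orthogonal quantum Latin squares of size 6; equivalently, there exists an AME(4,6) state in $(\mathbb{C}^6)^{\otimes4}$, and a multiunitary matrix of size 36. Consequently, orthogonal quantum Latin squares of size $N$ and AME(4,$N$) states exist for every $N\ge3$.
   Context: A pure state in $(\mathbb{C}^N)^{\otimes4}$ is AME(4,$N$) (absolutely maximally entangled) if its reduced density matrix on every pair of the four parties equals $\mathbb{I}_{N^2}/N^2$. An $N\times N$ array $\{|\psi_{ij}\rangle\}$ of vectors in $\mathbb{C}^N\otimes\mathbb{C}^N$ is a pair of orthogonal quantum Latin squares if: (1) it is an orthonormal basis of $\mathbb{C}^N\otimes\mathbb{C}^N$; (2) for each tensor factor $X$ and all $j,k$, $\mathrm{Tr}_X\sum_i|\psi_{ji}\rangle\langle\psi_{ki}|=\delta_{jk}\mathbb{I}_N$; (3) for each tensor factor $X$ and all $j,k$, $\mathrm{Tr}_X\sum_i|\psi_{ij}\rangle\langle\psi_{ik}|=\delta_{jk}\mathbb{I}_N$. For an $N^2\times N^2$ matrix $M$ indexed by pairs, $M^R_{(i,j),(k,l)}=M_{(i,k),(j,l)}$ and $M^\Gamma_{(i,j),(k,l)}=M_{(i,l),(k,j)}$; $M$ is multiunitary if $M$, $M^R$, $M^\Gamma$ are unitary. *)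

theory Defs
  imports Complex_Main
begin

text \<open>Vectors in C^N (x) C^N are functions v :: nat => nat => complex, v x y being the
coefficient of |x>|y>, with x,y < N. An N x N array of such vectors is
Q :: nat => nat => nat => nat => complex, Q i j being the vector psi_ij.\<close>

definition inner2 :: "nat \<Rightarrow> (nat \<Rightarrow> nat \<Rightarrow> complex) \<Rightarrow> (nat \<Rightarrow> nat \<Rightarrow> complex) \<Rightarrow> complex" where
  "inner2 N v w = (\<Sum>x<N. \<Sum>y<N. cnj (v x y) * w x y)"

definition orthonormal_basis_array :: "nat \<Rightarrow> (nat \<Rightarrow> nat \<Rightarrow> nat \<Rightarrow> nat \<Rightarrow> complex) \<Rightarrow> bool" where
  "orthonormal_basis_array N Q \<longleftrightarrow>
     (\<forall>i<N. \<forall>j<N. \<forall>k<N. \<forall>l<N.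
        inner2 N (Q i j) (Q k l) = (if i = k \<and> j = l then 1 else 0)) \<and>
     (\<forall>v :: nat \<Rightarrow> nat \<Rightarrow> complex. \<exists>c :: nat \<Rightarrow> nat \<Rightarrow> complex.
        \<forall>x<N. \<forall>y<N. v x y = (\<Sum>i<N. \<Sum>j<N. c i j * Q i j x y))"

text \<open>Partial traces of the operator |v><w| on C^N (x) C^N:
  ptrace1 traces out the first factor (result indexed by second-factor indices),
  ptrace2 traces out the second factor.\<close>
definition ptrace1 :: "nat \<Rightarrow> (nat \<Rightarrow> nat \<Rightarrow> complex) \<Rightarrow> (nat \<Rightarrow> nat \<Rightarrow> complex) \<Rightarrow> nat \<Rightarrow> nat \<Rightarrow> complex" where
  "ptrace1 N v w y y' = (\<Sum>x<N. v x y * cnj (w x y'))"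

definition ptrace2 :: "nat \<Rightarrow> (nat \<Rightarrow> nat \<Rightarrow> complex) \<Rightarrow> (nat \<Rightarrow> nat \<Rightarrow> complex) \<Rightarrow> nat \<Rightarrow> nat \<Rightarrow> complex" where
  "ptrace2 N v w x x' = (\<Sum>y<N. v x y * cnj (w x' y))"

definition OQLS :: "nat \<Rightarrow> (nat \<Rightarrow> nat \<Rightarrow> nat \<Rightarrow> nat \<Rightarrow> complex) \<Rightarrow> bool" where
  "OQLS N Q \<longleftrightarrow>
     orthonormal_basis_array N Q \<and>
     \<comment> \<open>(2): Tr_X sum_i |psi_ji><psi_ki| = delta_jk I, for both factors X\<close>
     (\<forall>j<N. \<forall>k<N. \<forall>a<N. \<forall>b<N.
        (\<Sum>i<N. ptrace1 N (Q j i) (Q k i) a b) = (if j = k \<and> a = b then 1 else 0) \<and>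
        (\<Sum>i<N. ptrace2 N (Q j i) (Q k i) a b) = (if j = k \<and> a = b then 1 else 0)) \<and>
     \<comment> \<open>(3): Tr_X sum_i |psi_ij><psi_ik| = delta_jk I, for both factors X\<close>
     (\<forall>j<N. \<forall>k<N. \<forall>a<N. \<forall>b<N.
        (\<Sum>i<N. ptrace1 N (Q i j) (Q i k) a b) = (if j = k \<and> a = b then 1 else 0) \<and>
        (\<Sum>i<N. ptrace2 N (Q i j) (Q i k) a b) = (if j = k \<and> a = b then 1 else 0))"

text \<open>Pure states in (C^N)^(x)4: psi a b c d is the coefficient of |a>|b>|c>|d>.\<close>
definition unit_state4 :: "nat \<Rightarrow> (nat \<Rightarrow> nat \<Rightarrow> nat \<Rightarrow> nat \<Rightarrow> complex) \<Rightarrow> bool" where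
  "unit_state4 N \<psi> \<longleftrightarrow> (\<Sum>a<N. \<Sum>b<N. \<Sum>c<N. \<Sum>d<N. (cmod (\<psi> a b c d))\<^sup>2) = 1"

definition red12 :: "nat \<Rightarrow> (nat \<Rightarrow> nat \<Rightarrow> nat \<Rightarrow> nat \<Rightarrow> complex) \<Rightarrow> nat \<Rightarrow> nat \<Rightarrow> nat \<Rightarrow> nat \<Rightarrow> complex" where
  "red12 N \<psi> a b a' b' = (\<Sum>c<N. \<Sum>d<N. \<psi> a b c d * cnj (\<psi> a' b' c d))"

definition maximally_mixed12 :: "nat \<Rightarrow> (nat \<Rightarrow> nat \<Rightarrow> nat \<Rightarrow> nat \<Rightarrow> complex) \<Rightarrow> bool" where
  "maximally_mixed12 N \<psi> \<longleftrightarrow>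
     (\<forall>a<N. \<forall>b<N. \<forall>a'<N. \<forall>b'<N.
        red12 N \<psi> a b a' b' = (if a = a' \<and> b = b' then 1 / of_nat (N^2) else 0))"

text \<open>AME(4,N): the reduced state on each of the six pairs of parties is I/N^2.
  Each pair {p,q} is moved to positions 1,2 by reordering the tensor factors.\<close>
definition AME4 :: "nat \<Rightarrow> (nat \<Rightarrow> nat \<Rightarrow> nat \<Rightarrow> nat \<Rightarrow> complex) \<Rightarrow> bool" where
  "AME4 N \<psi> \<longleftrightarrow> unit_state4 N \<psi> \<and>
     maximally_mixed12 N (\<lambda>a b c d. \<psi> a b c d) \<and>   \<comment> \<open>pair {1,2}\<close>
     maximally_mixed12 N (\<lambda>a b c d. \<psi> a c b d) \<and>   \<comment> \<open>pair {1,3}\<close>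
     maximally_mixed12 N (\<lambda>a b c d. \<psi> a c d b) \<and>   \<comment> \<open>pair {1,4}\<close>
     maximally_mixed12 N (\<lambda>a b c d. \<psi> c a b d) \<and>   \<comment> \<open>pair {2,3}\<close>
     maximally_mixed12 N (\<lambda>a b c d. \<psi> c a d b) \<and>   \<comment> \<open>pair {2,4}\<close>
     maximally_mixed12 N (\<lambda>a b c d. \<psi> c d a b)     \<comment> \<open>pair {3,4}\<close>"

text \<open>N^2 x N^2 matrices indexed by pairs: M i j k l = M_((i,j),(k,l)).\<close>
definition unitary_pair :: "nat \<Rightarrow> (nat \<Rightarrow> nat \<Rightarrow> nat \<Rightarrow> nat \<Rightarrow> complex) \<Rightarrow> bool" where
  "unitary_pair N M \<longleftrightarrow>
     (\<forall>i<N. \<forall>j<N. \<forall>k<N. \<forall>l<N.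
        (\<Sum>a<N. \<Sum>b<N. M i j a b * cnj (M k l a b)) = (if i = k \<and> j = l then 1 else 0) \<and>
        (\<Sum>a<N. \<Sum>b<N. cnj (M a b i j) * M a b k l) = (if i = k \<and> j = l then 1 else 0))"

definition realign :: "(nat \<Rightarrow> nat \<Rightarrow> nat \<Rightarrow> nat \<Rightarrow> complex) \<Rightarrow> nat \<Rightarrow> nat \<Rightarrow> nat \<Rightarrow> nat \<Rightarrow> complex" where
  "realign M i j k l = M i k j l"

definition partial_transpose :: "(nat \<Rightarrow> nat \<Rightarrow> nat \<Rightarrow> nat \<Rightarrow> complex) \<Rightarrow> nat \<Rightarrow> nat \<Rightarrow> nat \<Rightarrow> nat \<Rightarrow> complex" where
  "partial_transpose M i j k l = M i l k j"

definition multiunitary :: "nat \<Rightarrow> (nat \<Rightarrow> nat \<Rightarrow> nat \<Rightarrow> nat \<Rightarrow> complex) \<Rightarrow> bool" where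
  "multiunitary N M \<longleftrightarrow> unitary_pair N M \<and> unitary_pair N (realign M) \<and>
     unitary_pair N (partial_transpose M)"

end

(*
For N other than 6 the state comes from classical orthogonal Latin squares, i.e. from orthogonal
arrays with four columns. If N is odd, x, x + y, x + 2y, y mod N will do. If N is even and large,
write N = 3t + u with t coprime to 6 and u odd, u at most t: the rows x, x + y, x + 2y, x + 3y, y
mod t form an array with five columns, and Wilson's construction with ingredients of orders 3, 4
and u applies. This leaves 4, 8, 10, 14, for which there are self-orthogonal Latin squares with a
cyclic automorphism of order N - 1, and the products 12, 30, 32.

For N = 6 take a matrix that is diagonal in the generalised Bell basis. Its eigenvalues are cube
roots of unity, so multiunitarity is a finite computation with Eisenstein integers.
*)

theory Submission
  imports Defs "HOL-Number_Theory.Cong" "HOL-Library.Product_Plus"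
begin

section \<open>Multiunitary matrices\<close>

text \<open>Columns are handled through the transpose, so the three unitarity conditions become six
  instances of one predicate, one for each pair of the four indices used as row index.\<close>

definition orthonormal_rows :: "nat \<Rightarrow> (nat \<Rightarrow> nat \<Rightarrow> nat \<Rightarrow> nat \<Rightarrow> complex) \<Rightarrow> bool" where
  "orthonormal_rows N M \<longleftrightarrow> (\<forall>i<N. \<forall>j<N. \<forall>k<N. \<forall>l<N.
     (\<Sum>a<N. \<Sum>b<N. M i j a b * cnj (M k l a b)) = (if i = k \<and> j = l then 1 else 0))"

lemma unitary_pair_iff_orthonormal_rows:
  "unitary_pair N M \<longleftrightarrow> orthonormal_rows N M \<and> orthonormal_rows N (\<lambda>i j a b. M a b i j)"
  unfolding unitary_pair_def orthonormal_rows_def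
  by (auto simp: mult.commute)

lemma orthonormal_rows_swap_columns:
  assumes "orthonormal_rows N M"
  shows "orthonormal_rows N (\<lambda>i j a b. M i j b a)"
proof -
  have "(\<Sum>a<N. \<Sum>b<N. M i j b a * cnj (M k l b a)) = (\<Sum>a<N. \<Sum>b<N. M i j a b * cnj (M k l a b))"
    for i j k l
    by (rule sum.swap)
  then show ?thesis using assms unfolding orthonormal_rows_def by simp
qed

lemma orthonormal_rows_swap_rows:
  assumes "orthonormal_rows N M"
  shows "orthonormal_rows N (\<lambda>i j a b. M j i a b)"
  using assms unfolding orthonormal_rows_def by auto

lemma multiunitary_rows:
  assumes "multiunitary N M"
  shows "orthonormal_rows N M" "orthonormal_rows N (\<lambda>i j a b. M a b i j)"
    "orthonormal_rows N (\<lambda>i j a b. M i a j b)" "orthonormal_rows N (\<lambda>i j a b. M a i b j)"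
    "orthonormal_rows N (\<lambda>i j a b. M i a b j)" "orthonormal_rows N (\<lambda>i j a b. M a i j b)"
proof -
  note m = assms[unfolded multiunitary_def unitary_pair_iff_orthonormal_rows realign_def
      partial_transpose_def]
  show "orthonormal_rows N M" "orthonormal_rows N (\<lambda>i j a b. M a b i j)"
    "orthonormal_rows N (\<lambda>i j a b. M i a j b)" "orthonormal_rows N (\<lambda>i j a b. M a i b j)"
    using m by simp_all
  show "orthonormal_rows N (\<lambda>i j a b. M i a b j)"
    using m orthonormal_rows_swap_columns[of N "\<lambda>i j a b. M i b a j"] by simp
  show "orthonormal_rows N (\<lambda>i j a b. M a i j b)"
    using m orthonormal_rows_swap_rows[of N "\<lambda>i j a b. M a j i b"] by simp
qed

section \<open>From multiunitary matrices to quantum Latin squares and AME states\<close>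

lemma sum_swap_pairs:
  "(\<Sum>i\<in>A. \<Sum>j\<in>B. \<Sum>a\<in>C. \<Sum>b\<in>D. g i j a b) =
   (\<Sum>a\<in>C. \<Sum>b\<in>D. \<Sum>i\<in>A. \<Sum>j\<in>B. (g i j a b :: 'z :: comm_monoid_add))"
proof -
  have swap: "(\<Sum>j\<in>B. \<Sum>a\<in>C. \<Sum>b\<in>D. h j a b) = (\<Sum>a\<in>C. \<Sum>b\<in>D. \<Sum>j\<in>B. h j a b)"
    for B and h :: "_ \<Rightarrow> _ \<Rightarrow> _ \<Rightarrow> 'z"
    by (subst sum.swap, intro sum.cong refl, rule sum.swap)
  have "(\<Sum>i\<in>A. \<Sum>j\<in>B. \<Sum>a\<in>C. \<Sum>b\<in>D. g i j a b) = (\<Sum>i\<in>A. \<Sum>a\<in>C. \<Sum>b\<in>D. \<Sum>j\<in>B. g i j a b)"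
    by (intro sum.cong refl swap)
  also have "\<dots> = (\<Sum>a\<in>C. \<Sum>b\<in>D. \<Sum>i\<in>A. \<Sum>j\<in>B. g i j a b)"
    by (rule swap)
  finally show ?thesis .
qed

text \<open>The vector at (i, j) is row (i, j) of \<open>M\<close>. The four partial trace
  conditions are the four index pairs that mix a row index with a column index.\<close>

lemma OQLS_of_multiunitary:
  assumes "multiunitary N M"
  shows "OQLS N M"
proof -
  note r = multiunitary_rows[OF assms, unfolded orthonormal_rows_def]
  have "\<exists>c. \<forall>x<N. \<forall>y<N. v x y = (\<Sum>i<N. \<Sum>j<N. c i j * M i j x y)" for v :: "nat \<Rightarrow> nat \<Rightarrow> complex"
  proof (intro exI allI impI)
    fix x y assume xy: "x < N" "y < N"
    \<comment> \<open>The coefficients are the inner products of the rows with \<open>v\<close>;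
      orthonormality of the columns recovers \<open>v\<close>.\<close>
    have "(\<Sum>i<N. \<Sum>j<N. (\<Sum>a<N. \<Sum>b<N. v a b * cnj (M i j a b)) * M i j x y) =
      (\<Sum>i<N. \<Sum>j<N. \<Sum>a<N. \<Sum>b<N. v a b * (M i j x y * cnj (M i j a b)))"
      by (simp add: sum_distrib_left sum_distrib_right mult_ac)
    also have "\<dots> = (\<Sum>a<N. \<Sum>b<N. v a b * (\<Sum>i<N. \<Sum>j<N. M i j x y * cnj (M i j a b)))"
      by (subst sum_swap_pairs) (simp add: sum_distrib_left)
    also have "\<dots> = (\<Sum>a<N. \<Sum>b<N. if b = y then (if a = x then v x y else 0) else 0)"
      by (intro sum.cong refl) (use r(2) xy in auto)
    also have "\<dots> = v x y" using xy by simp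
    finally show "v x y = (\<Sum>i<N. \<Sum>j<N. (\<Sum>a<N. \<Sum>b<N. v a b * cnj (M i j a b)) * M i j x y)"
      by simp
  qed
  moreover have "inner2 N (M i j) (M k l) = (if i = k \<and> j = l then 1 else 0)"
    if "i < N" "j < N" "k < N" "l < N" for i j k l
    using r(1)[rule_format, of k l i j] that by (auto simp: inner2_def mult.commute)
  ultimately have "orthonormal_basis_array N M"
    unfolding orthonormal_basis_array_def by blast
  then show ?thesis
    using r(3-6) unfolding OQLS_def ptrace1_def ptrace2_def by simp
qed

lemma maximally_mixed12_of_orthonormal_rows:
  assumes "orthonormal_rows N M"
  shows "maximally_mixed12 N (\<lambda>a b c d. M a b c d / of_nat N)"
  using assms unfolding orthonormal_rows_def maximally_mixed12_def red12_def
  by (simp add: sum_divide_distrib[symmetric] power2_eq_square)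

text \<open>The squared norm is the trace of the reduced state, which has N^2 diagonal entries
  1/N^2.\<close>

lemma unit_state4_of_maximally_mixed12:
  assumes "maximally_mixed12 N \<psi>" "0 < N"
  shows "unit_state4 N \<psi>"
proof -
  have "complex_of_real (\<Sum>c<N. \<Sum>d<N. (cmod (\<psi> a b c d))\<^sup>2) = 1 / of_nat (N^2)" if "a < N" "b < N" for a b
    using assms(1) that
    by (simp only: of_real_sum complex_norm_square maximally_mixed12_def red12_def) simp
  then have "complex_of_real (\<Sum>a<N. \<Sum>b<N. \<Sum>c<N. \<Sum>d<N. (cmod (\<psi> a b c d))\<^sup>2) = 1"
    using assms(2) by (simp add: power2_eq_square)
  then show ?thesis
    unfolding unit_state4_def using of_real_eq_1_iff by blast
qed

lemma AME4_of_multiunitary: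
  assumes "multiunitary N M" "0 < N"
  shows "AME4 N (\<lambda>a b c d. M a b c d / of_nat N)"
proof -
  note mm = multiunitary_rows[OF assms(1), THEN maximally_mixed12_of_orthonormal_rows]
  then show ?thesis
    unfolding AME4_def using unit_state4_of_maximally_mixed12[OF mm(1) assms(2)] by simp
qed


section \<open>Orthogonal arrays\<close>

text \<open>Strength 2 and index 1. Rows are indexed by an arbitrary set, so that constructions can
  use products, sums and options.\<close>

definition orthogonal_array :: "nat \<Rightarrow> 'a set \<Rightarrow> 'r set \<Rightarrow> ('r \<Rightarrow> nat \<Rightarrow> 'a) \<Rightarrow> bool" where
  "orthogonal_array k V R f \<longleftrightarrow>
     (\<forall>i<k. \<forall>j<k. i \<noteq> j \<longrightarrow> bij_betw (\<lambda>r. (f r i, f r j)) R (V \<times> V))"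

lemma orthogonal_array_bij:
  assumes "orthogonal_array k V R f" "i < k" "j < k" "i \<noteq> j"
  shows "bij_betw (\<lambda>r. (f r i, f r j)) R (V \<times> V)"
  using assms by (simp add: orthogonal_array_def)

lemma orthogonal_array_eq:
  assumes "orthogonal_array k V R f" "i < k" "j < k" "i \<noteq> j" "r \<in> R" "s \<in> R"
    "f r i = f s i" "f r j = f s j"
  shows "r = s"
  using bij_betw_imp_inj_on[OF orthogonal_array_bij[OF assms(1-4)]] assms(5-8)
  by (auto simp: inj_on_def)

lemma orthogonal_array_row:
  assumes "orthogonal_array k V R f" "i < k" "j < k" "i \<noteq> j" "x \<in> V" "y \<in> V"
  obtains r where "r \<in> R" "f r i = x" "f r j = y"
proof -
  have "(x, y) \<in> (\<lambda>r. (f r i, f r j)) ` R"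
    using bij_betw_imp_surj_on[OF orthogonal_array_bij[OF assms(1-4)]] assms(5,6) by simp
  then show thesis using that by auto
qed

lemma orthogonal_array_mem:
  assumes "orthogonal_array k V R f" "i < k" "2 \<le> k" "r \<in> R"
  shows "f r i \<in> V"
proof -
  obtain j where j: "j < k" "j \<noteq> i"
    using assms(3) by (cases "i = 0") (auto intro: that[of 0] that[of 1])
  then show ?thesis
    using bij_betw_imp_surj_on[OF orthogonal_array_bij[OF assms(1,2) j(1)]] assms(4) by auto
qed

text \<open>Coverage comes from counting: an injection between finite sets of equal size is
  onto.\<close>

lemma orthogonal_arrayI:
  assumes inj: "\<And>i j r s. i < k \<Longrightarrow> j < k \<Longrightarrow> i \<noteq> j \<Longrightarrow> r \<in> R \<Longrightarrow> s \<in> R \<Longrightarrow>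
      f r i = f s i \<Longrightarrow> f r j = f s j \<Longrightarrow> r = s"
    and mem: "\<And>i r. i < k \<Longrightarrow> r \<in> R \<Longrightarrow> f r i \<in> V"
    and "finite V" and card: "card R = card V * card V"
  shows "orthogonal_array k V R f"
  unfolding orthogonal_array_def
proof (intro allI impI)
  fix i j assume ij: "i < k" "j < k" "i \<noteq> j"
  let ?g = "\<lambda>r. (f r i, f r j)"
  have inj': "inj_on ?g R" using inj[OF ij] by (auto simp: inj_on_def)
  have "?g ` R \<subseteq> V \<times> V" using mem ij by auto
  moreover have "card (?g ` R) = card (V \<times> V)"
    using card_image[OF inj'] card by (simp add: card_cartesian_product)
  ultimately have "?g ` R = V \<times> V" using \<open>finite V\<close> by (intro card_subset_eq) auto
  with inj' show "bij_betw ?g R (V \<times> V)" by (simp add: bij_betw_def)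
qed

lemma orthogonal_array_card:
  assumes "orthogonal_array k V R f" "2 \<le> k"
  shows "card R = card V * card V"
  using bij_betw_same_card[OF orthogonal_array_bij[OF assms(1), of 0 1]] assms(2)
  by (simp add: card_cartesian_product)

section \<open>Product, linear, cyclic and Wilson constructions of orthogonal arrays\<close>

lemma orthogonal_array_product:
  assumes f: "orthogonal_array k V R f" and g: "orthogonal_array k W S g"
    and "2 \<le> k" "finite V" "finite W"
  shows "orthogonal_array k (V \<times> W) (R \<times> S) (\<lambda>(r, s) i. (f r i, g s i))"
proof (rule orthogonal_arrayI)
  show "card (R \<times> S) = card (V \<times> W) * card (V \<times> W)"
    using orthogonal_array_card[OF f \<open>2 \<le> k\<close>] orthogonal_array_card[OF g \<open>2 \<le> k\<close>]
    by (simp add: card_cartesian_product)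
qed (use assms orthogonal_array_eq[OF f] orthogonal_array_eq[OF g]
      orthogonal_array_mem[OF f] orthogonal_array_mem[OF g] in auto)

text \<open>Columns 1 \<le> i < j determine (j - i) y modulo \<open>t\<close>, where j - i is at
  most k - 2; column 0 is y itself. Given y, any column other than 0 determines x.\<close>

lemma orthogonal_array_linear:
  fixes t :: nat
  assumes "0 < t" and cop: "\<And>d. 1 \<le> d \<Longrightarrow> d + 1 < k \<Longrightarrow> coprime d t"
  shows "orthogonal_array k {..<t} ({..<t} \<times> {..<t})
           (\<lambda>(x, y) i. if i = 0 then y else (x + i * y) mod t)"
proof (rule orthogonal_arrayI)
  have cancel: "y = y'"
    if "1 \<le> i" "i < j" "j < k" "y < t" "y' < t" "(x + i * y) mod t = (x' + i * y') mod t"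
      "(x + j * y) mod t = (x' + j * y') mod t" for i j x y x' y'
  proof -
    have "[int (x + i * y) = int (x' + i * y')] (mod int t)"
      "[int (x + j * y) = int (x' + j * y')] (mod int t)"
      using that(6,7) by (metis cong_def cong_int_iff)+
    from cong_diff[OF this(2,1)]
    have "[int (j - i) * int y = int (j - i) * int y'] (mod int t)"
      using that(2) by (simp add: of_nat_diff algebra_simps)
    moreover have "coprime (int (j - i)) (int t)"
      using cop[of "j - i"] that(1-3) by (simp only: coprime_int_iff)
    ultimately have "[int y = int y'] (mod int t)"
      by (simp add: cong_mult_lcancel)
    then show ?thesis using that(4,5) by (simp add: cong_int_iff cong_def)
  qed
  have cancel': "x = x'"
    if "x < t" "x' < t" "(x + c) mod t = (x' + c) mod t" for x x' c :: nat
    using that cong_add_rcancel_nat[of x c x' t] by (simp add: cong_def)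
  fix i j r s
  assume *: "i < k" "j < k" "i \<noteq> j" "r \<in> {..<t} \<times> {..<t}" "s \<in> {..<t} \<times> {..<t}"
    "(case r of (x, y) \<Rightarrow> \<lambda>i. if i = 0 then y else (x + i * y) mod t) i =
     (case s of (x, y) \<Rightarrow> \<lambda>i. if i = 0 then y else (x + i * y) mod t) i"
    "(case r of (x, y) \<Rightarrow> \<lambda>i. if i = 0 then y else (x + i * y) mod t) j =
     (case s of (x, y) \<Rightarrow> \<lambda>i. if i = 0 then y else (x + i * y) mod t) j"
  obtain x y x' y' where rs: "r = (x, y)" "s = (x', y')" by (cases r, cases s)
  have lt: "x < t" "y < t" "x' < t" "y' < t" using *(4,5) rs by auto
  have y: "y = y'"
  proof (cases "i = 0 \<or> j = 0")
    case True then show ?thesis using * rs by auto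
  next
    case False
    then have "(x + i * y) mod t = (x' + i * y') mod t" "(x + j * y) mod t = (x' + j * y') mod t"
      "1 \<le> i" "1 \<le> j"
      using * rs by auto
    then show ?thesis using cancel[of i j y y' x x'] cancel[of j i y y' x x'] * lt
      by (metis linorder_neqE_nat)
  qed
  obtain l where "l = i \<or> l = j" "l \<noteq> 0" using \<open>i \<noteq> j\<close> by metis
  then have "(x + l * y) mod t = (x' + l * y) mod t" using * rs y by auto
  then show "r = s" using cancel'[of x x' "l * y"] lt rs y by simp
qed (use \<open>0 < t\<close> in \<open>auto simp: card_cartesian_product split: if_splits\<close>)

text \<open>The symbol -1 is a point at infinity, fixed by the cyclic shift; -1 and -2 also serve as labels
  distinct from all residues, so that distinctness covers the pairs with a point at infinity.\<close>
lemma orthogonal_array_cyclic: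
  fixes B :: "int list list" and m :: nat
  assumes len: "length B = m + 2" and "0 < m"
    and mem: "\<And>b i. b \<in> set B \<Longrightarrow> i < k \<Longrightarrow> b ! i \<in> {-1..<int m}"
    and diff: "\<And>i j. i < k \<Longrightarrow> j < k \<Longrightarrow> i \<noteq> j \<Longrightarrow>
      distinct (map (\<lambda>b. if b ! i = -1 then -1 else if b ! j = -1 then -2
                          else (b ! i - b ! j) mod int m) B)"
    and inf: "\<And>b i j. b \<in> set B \<Longrightarrow> i < k \<Longrightarrow> j < k \<Longrightarrow> i \<noteq> j \<Longrightarrow> b ! i \<noteq> -1 \<or> b ! j \<noteq> -1"
  shows "orthogonal_array k {-1..<int m} (insert None (Some ` ({0..<int m} \<times> {..<m + 2})))
    (\<lambda>r i. case r of None \<Rightarrow> -1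
       | Some (h, n) \<Rightarrow> if B ! n ! i = -1 then -1 else (B ! n ! i + h) mod int m)"
    (is "orthogonal_array k ?V ?R ?f")
proof (rule orthogonal_arrayI)
  \<comment> \<open>One constant row and \<open>m\<close> shifts of m + 2 base rows: 1 + m (m + 2) =
    (m + 1)^2.\<close>
  show "card ?R = card ?V * card ?V"
    by (subst card_insert_disjoint) (auto simp: card_image card_cartesian_product algebra_simps nat_add_distrib)
  have nonneg: "z mod int m \<noteq> -1" for z using \<open>0 < m\<close>
    by (metis Euclidean_Rings.pos_mod_sign not_one_le_zero neg_0_le_iff_le of_nat_0_less_iff)
  fix i j r s
  assume ij: "i < k" "j < k" "i \<noteq> j" and rs: "r \<in> ?R" "s \<in> ?R"
    and eq: "?f r i = ?f s i" "?f r j = ?f s j"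
  have const: "False" if "Some (h, n) \<in> ?R" "?f (Some (h, n)) i = -1" "?f (Some (h, n)) j = -1" for h n
    using that inf[of "B ! n" i j] ij len nonneg by (auto split: if_splits)
  have const': "q = None" if "q \<in> ?R" "?f q i = -1" "?f q j = -1" for q
  proof (cases q)
    case (Some hn)
    then show ?thesis using const[of "fst hn" "snd hn"] that by simp
  qed
  show "r = s"
  proof (cases "r = None \<or> s = None")
    case True
    then have "r = None \<and> s = None" using const'[OF rs(1)] const'[OF rs(2)] eq by auto
    then show ?thesis by simp
  next
    case False
    then obtain h n h' n' where rs': "r = Some (h, n)" "s = Some (h', n')" by auto
    let ?b = "B ! n" and ?b' = "B ! n'"
    have n: "n < m + 2" "n' < m + 2" and h: "h \<in> {0..<int m}" "h' \<in> {0..<int m}"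
      using rs rs' by auto
    have shift: "?b ! l = -1 \<longleftrightarrow> ?b' ! l = -1" "?b ! l \<noteq> -1 \<Longrightarrow> [?b ! l + h = ?b' ! l + h'] (mod int m)"
      if "l \<in> {i, j}" for l
      using that eq rs' nonneg by (auto simp: cong_def split: if_splits)
    \<comment> \<open>Shifting preserves differences and the places of the point at infinity, so the
      label identifies the base row; a finite entry then identifies the shift.\<close>
    have "(if ?b ! i = -1 then -1 else if ?b ! j = -1 then -2 else (?b ! i - ?b ! j) mod int m) =
      (if ?b' ! i = -1 then -1 else if ?b' ! j = -1 then -2 else (?b' ! i - ?b' ! j) mod int m)"
      using shift cong_diff[OF shift(2)[of i] shift(2)[of j]] by (auto simp: cong_def)
    then have "n = n'"
      using diff[OF ij] n len by (auto simp: distinct_conv_nth)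
    moreover obtain l where "l \<in> {i, j}" "?b ! l \<noteq> -1" using inf[of ?b i j] ij n len by auto
    ultimately have "[h = h'] (mod int m)" using shift(2)[of l] by (simp add: cong_add_lcancel)
    then have "h = h'" using h by (simp add: cong_def)
    with \<open>n = n'\<close> show ?thesis using rs' by simp
  qed
next
  fix i r assume "i < k" "r \<in> ?R"
  moreover have "0 \<le> c mod int m" "c mod int m < int m" for c
    using \<open>0 < m\<close> by simp_all
  then have "c mod int m \<in> {-1..<int m}" for c
    by (meson atLeastLessThan_iff order_trans neg_le_0_iff_le zero_le_one)
  ultimately show "?f r i \<in> ?V"
    using \<open>0 < m\<close> by (cases r) auto
qed auto

text \<open>Wilson's construction: V \<times> A is the inflation of the first k groups of a transversal design,
  and U the part of the last group that survives truncation. A block that misses U is replaced by a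
  copy of A; a block through w in U by a copy of insert z A, with z renamed w in every column and the
  constant row omitted, since all constant pairs over U are covered by the array on U.\<close>
lemma orthogonal_array_wilson:
  assumes V: "orthogonal_array (Suc k) V R f" and U: "U \<subseteq> V" and k: "2 \<le> k"
    and A: "orthogonal_array k A RA fA"
    and B: "orthogonal_array k (insert z A) RB fB" "z \<notin> A" "r0 \<in> RB" "\<And>i. i < k \<Longrightarrow> fB r0 i = z"
    and C: "orthogonal_array k U RU fU"
  shows "orthogonal_array k ((V \<times> A) <+> U)
     (({r \<in> R. f r k \<notin> U} \<times> RA) <+> (({r \<in> R. f r k \<in> U} \<times> (RB - {r0})) <+> RU))
     (\<lambda>q i. case q of Inl (r, s) \<Rightarrow> Inl (f r i, fA s i)
       | Inr (Inl (r, s)) \<Rightarrow> if fB s i = z then Inr (f r k) else Inl (f r i, fB s i)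
       | Inr (Inr r) \<Rightarrow> Inr (fU r i))"
    (is "orthogonal_array k ?V ?R ?f")
  unfolding orthogonal_array_def
proof (intro allI impI)
  fix i j assume ij: "i < k" "j < k" "i \<noteq> j"
  then have ij': "i < Suc k" "j < Suc k" "k < Suc k" "i \<noteq> k" "j \<noteq> k" by auto
  note eqV = orthogonal_array_eq[OF V] and eqA = orthogonal_array_eq[OF A ij]
    and eqB = orthogonal_array_eq[OF B(1) ij] and eqC = orthogonal_array_eq[OF C ij]
  \<comment> \<open>Without \<open>r0\<close>, no filled block has symbols of \<open>U\<close> in
    both columns, so none collides with a row of the array on \<open>U\<close>.\<close>
  have r0: "s = r0" if "s \<in> RB" "fB s i = z" "fB s j = z" for s
    using eqB[OF that(1) B(3)] that B(4) ij by simp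
  have eqV1: "r = s" if "r \<in> R" "s \<in> R" "f r i = f s i" "f r j = f s j" for r s
    using eqV[OF ij'(1,2) ij(3)] that by blast
  have eqV2: "r = s" if "r \<in> R" "s \<in> R" "f r i = f s i" "f r k = f s k" for r s
    using eqV[OF ij'(1,3,4)] that by blast
  have eqV3: "r = s" if "r \<in> R" "s \<in> R" "f r j = f s j" "f r k = f s k" for r s
    using eqV[OF ij'(2,3,5)] that by blast
  have RV: "f r l \<in> V" if "r \<in> R" "l < Suc k" for r l
    using orthogonal_array_mem[OF V that(2) _ that(1)] k by simp
  have inj: "inj_on (\<lambda>q. (?f q i, ?f q j)) ?R"
  proof (rule inj_onI)
    fix p q assume "p \<in> ?R" "q \<in> ?R" "(?f p i, ?f p j) = (?f q i, ?f q j)"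
    then show "p = q"
      by (elim PlusE SigmaE; clarsimp split: if_splits)
        (use eqV1 eqV2 eqV3 eqA eqB eqC r0 in \<open>metis+\<close>)
  qed
  have "?f q l \<in> ?V" if "q \<in> ?R" "l < k" for q l
  proof -
    have "fB s l = z \<or> fB s l \<in> A" if "s \<in> RB" for s
      using orthogonal_array_mem[OF B(1) \<open>l < k\<close> k that] by simp
    then show ?thesis
      using that RV[of _ l] orthogonal_array_mem[OF A \<open>l < k\<close> k]
        orthogonal_array_mem[OF C \<open>l < k\<close> k] by (elim PlusE SigmaE) auto
  qed
  then have sub: "(\<lambda>q. (?f q i, ?f q j)) ` ?R \<subseteq> ?V \<times> ?V"
    using ij by blast
  have ex: "\<exists>q\<in>?R. ?f q i = x \<and> ?f q j = y" if xy: "x \<in> ?V" "y \<in> ?V" for x y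
  proof -
    consider
        (1) v a w b where "x = Inl (v, a)" "y = Inl (w, b)" "v \<in> V" "w \<in> V" "a \<in> A" "b \<in> A"
      | (2) v a w where "x = Inl (v, a)" "y = Inr w" "v \<in> V" "a \<in> A" "w \<in> U"
      | (3) v a w where "y = Inl (v, a)" "x = Inr w" "v \<in> V" "a \<in> A" "w \<in> U"
      | (4) v w where "x = Inr v" "y = Inr w" "v \<in> U" "w \<in> U"
      using xy by (elim PlusE SigmaE) blast+
    then show ?thesis
    proof cases
      case x: 1
      obtain r where r: "r \<in> R" "f r i = v" "f r j = w"
        using orthogonal_array_row[OF V ij'(1,2) ij(3) x(3,4)] .
      \<comment> \<open>The last entry of \<open>r\<close> decides which ingredient fills the
        block.\<close>
      show ?thesis
      proof (cases "f r k \<in> U")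
        case True
        obtain s where "s \<in> RB" "fB s i = a" "fB s j = b"
          using orthogonal_array_row[OF B(1) ij, of a b] x by auto
        moreover from this have "s \<noteq> r0" "a \<noteq> z" "b \<noteq> z"
            using x(5,6) B(2) B(4)[OF ij(1)] by metis+
        ultimately show ?thesis
          using r x True by (intro bexI[of _ "Inr (Inl (r, s))"]) auto
      next
        case False
        obtain s where "s \<in> RA" "fA s i = a" "fA s j = b"
          using orthogonal_array_row[OF A ij x(5,6)] .
        then show ?thesis
          using r x False by (intro bexI[of _ "Inl (r, s)"]) auto
      qed
    next
      case x: 2
      \<comment> \<open>The block is fixed by \<open>v\<close> and its point \<open>w\<close> in the
        truncated group; inside it, \<open>z\<close> stands for \<open>w\<close>.\<close>
      obtain r where "r \<in> R" "f r i = v" "f r k = w"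
        using orthogonal_array_row[OF V ij'(1,3,4) x(3)] x(5) U by blast
      moreover obtain s where "s \<in> RB" "fB s i = a" "fB s j = z"
        using orthogonal_array_row[OF B(1) ij, of a z] x by auto
      moreover from this have "s \<noteq> r0" "a \<noteq> z"
        using x(4) B(2) B(4)[OF ij(1)] B(4)[OF ij(2)] by metis+
      ultimately show ?thesis
        using x by (intro bexI[of _ "Inr (Inl (r, s))"]) auto
    next
      case x: 3
      obtain r where "r \<in> R" "f r j = v" "f r k = w"
        using orthogonal_array_row[OF V ij'(2,3,5) x(3)] x(5) U by blast
      moreover obtain s where "s \<in> RB" "fB s j = a" "fB s i = z"
        using orthogonal_array_row[OF B(1) ij(2,1) ij(3)[symmetric], of a z] x by auto
      moreover from this have "s \<noteq> r0" "a \<noteq> z"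
        using x(4) B(2) B(4)[OF ij(1)] B(4)[OF ij(2)] by metis+
      ultimately show ?thesis
        using x by (intro bexI[of _ "Inr (Inl (r, s))"]) auto
    next
      case x: 4
      obtain r where "r \<in> RU" "fU r i = v" "fU r j = w"
        using orthogonal_array_row[OF C ij x(3,4)] .
      then show ?thesis
        using x by (intro bexI[of _ "Inr (Inr r)"]) auto
    qed
  qed
  have "p \<in> (\<lambda>q. (?f q i, ?f q j)) ` ?R" if "p \<in> ?V \<times> ?V" for p
  proof -
    have "fst p \<in> ?V" "snd p \<in> ?V" using that by (simp_all only: mem_Times_iff)
    from ex[OF this] obtain q where q: "q \<in> ?R" "?f q i = fst p \<and> ?f q j = snd p"
      by (rule bexE)
    have "p = (?f q i, ?f q j)" by (simp only: q(2) prod.collapse)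
    then show ?thesis by (rule image_eqI[OF _ q(1)])
  qed
  then show "bij_betw (\<lambda>q. (?f q i, ?f q j)) ?R (?V \<times> ?V)"
    unfolding bij_betw_def by (intro conjI[OF inj subset_antisym[OF sub subsetI]])
qed

section \<open>Arrays with four columns for every order from 3 on except 6\<close>

lemma orthogonal_array_image:
  assumes "orthogonal_array k V R f" "bij_betw g V W"
  shows "orthogonal_array k W R (\<lambda>r i. g (f r i))"
  unfolding orthogonal_array_def
proof (intro allI impI)
  fix i j assume "i < k" "j < k" "i \<noteq> j"
  from bij_betw_trans[OF orthogonal_array_bij[OF assms(1) this] bij_betw_map_prod[OF assms(2,2)]]
  show "bij_betw (\<lambda>r. (g (f r i), g (f r j))) R (W \<times> W)" by (simp add: comp_def)
qed

lemma orthogonal_array_reindex: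
  assumes "orthogonal_array k V R f" "bij_betw h S R"
  shows "orthogonal_array k V S (\<lambda>s. f (h s))"
  unfolding orthogonal_array_def
proof (intro allI impI)
  fix i j assume "i < k" "j < k" "i \<noteq> j"
  from bij_betw_trans[OF assms(2) orthogonal_array_bij[OF assms(1) this]]
  show "bij_betw (\<lambda>s. (f (h s) i, f (h s) j)) S (V \<times> V)" by (simp add: comp_def)
qed

text \<open>Fixing the row type to \<open>nat \<times> nat\<close> loses nothing: the entries in
  columns 0 and 1 can serve as row index.\<close>

definition has_oa4 :: "nat \<Rightarrow> bool" where
  "has_oa4 n \<longleftrightarrow> (\<exists>(R :: (nat \<times> nat) set) f. orthogonal_array 4 {..<n} R f)"

lemma has_oa4I:
  assumes "orthogonal_array 4 V R f" "finite V" "card V = n"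
  shows "has_oa4 n"
proof -
  obtain g where g: "bij_betw g V {..<n}"
    using ex_bij_betw_finite_nat[OF assms(2)] assms(3) by (auto simp: atLeast0LessThan)
  have *: "orthogonal_array 4 {..<n} R (\<lambda>r i. g (f r i))"
    using orthogonal_array_image[OF assms(1) g] .
  have "bij_betw (\<lambda>r. (g (f r 0), g (f r 1))) R ({..<n} \<times> {..<n})"
    by (rule orthogonal_array_bij[OF *]) auto
  from orthogonal_array_reindex[OF * bij_betw_inv_into[OF this]]
  show ?thesis unfolding has_oa4_def by blast
qed

lemma has_oa4_product:
  assumes "has_oa4 m" "has_oa4 n"
  shows "has_oa4 (m * n)"
proof -
  obtain R f S g where "orthogonal_array 4 {..<m} (R :: (nat \<times> nat) set) f"
    "orthogonal_array 4 {..<n} (S :: (nat \<times> nat) set) g"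
    using assms unfolding has_oa4_def by blast
  from orthogonal_array_product[OF this] show ?thesis
    by (rule has_oa4I) (auto simp: card_cartesian_product)
qed

lemma has_oa4_odd:
  assumes "odd n"
  shows "has_oa4 n"
proof -
  have "coprime d n" if "1 \<le> d" "d + 1 < 4" for d
  proof -
    have "d \<in> {1, 2}" using that by auto
    then show ?thesis using assms by auto
  qed
  from orthogonal_array_linear[of n 4, OF _ this] show ?thesis
    using assms by (intro has_oa4I) (auto intro: odd_pos)
qed

text \<open>The hypotheses of \<open>orthogonal_array_cyclic\<close> for four columns, with
  quantifiers over lists so that evaluation decides them.\<close>

definition cyclic_base :: "nat \<Rightarrow> int list list \<Rightarrow> bool" where
  "cyclic_base m B \<longleftrightarrow> length B = m + 2 \<and>
     (\<forall>i\<in>set [0..<4]. (\<forall>b\<in>set B. -1 \<le> b ! i \<and> b ! i < int m) \<and>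
     (\<forall>j\<in>set [0..<4]. i \<noteq> j \<longrightarrow> (\<forall>b\<in>set B. b ! i \<noteq> -1 \<or> b ! j \<noteq> -1) \<and>
      distinct (map (\<lambda>b. if b ! i = -1 then -1 else if b ! j = -1 then -2
                          else (b ! i - b ! j) mod int m) B)))"

text \<open>The bases below are orbit representatives of the rows (x, y, L x y, L y x), for self-orthogonal
  Latin squares L that commute with the cyclic shift.\<close>
definition starter3 :: "int list list" where
  "starter3 = [[0, 0, 0, 0], [0, 1, -1, 2], [0, 2, 1, -1], [0, -1, 2, 1], [-1, 0, 1, 2]]"

lemma cyclic_base_starter3: "cyclic_base 3 starter3" by code_simp

lemma orthogonal_array_cyclic_base:
  assumes "cyclic_base m B" "0 < m"
  shows "orthogonal_array 4 {-1..<int m} (insert None (Some ` ({0..<int m} \<times> {..<m + 2})))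
    (\<lambda>r i. case r of None \<Rightarrow> -1
       | Some (h, n) \<Rightarrow> if B ! n ! i = -1 then -1 else (B ! n ! i + h) mod int m)"
  by (rule orthogonal_array_cyclic)
    (use assms in \<open>auto simp: cyclic_base_def Ball_def set_upt simp del: upt_rec_numeral\<close>)

lemma has_oa4_cyclic_base:
  assumes "cyclic_base m B" "0 < m"
  shows "has_oa4 (Suc m)"
  by (rule has_oa4I[OF orthogonal_array_cyclic_base[OF assms]]) auto

lemma has_oa4_8: "has_oa4 8"
proof -
  have "cyclic_base 7
      [[0, 0, 0, 0], [0, 1, -1, 3], [0, 2, 1, 5], [0, 3, 4, 2], [0, 4, 6, 1], [0, 5, 3, 6],
       [0, 6, 2, -1], [0, -1, 5, 4], [-1, 0, 4, 5]]"
    by code_simp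
  from has_oa4_cyclic_base[OF this] show ?thesis by simp
qed

lemma has_oa4_10: "has_oa4 10"
proof -
  have "cyclic_base 9
      [[0, 0, 0, 0], [0, 1, -1, 3], [0, 2, 3, 8], [0, 3, 5, 7], [0, 4, 8, 5], [0, 5, 1, 4],
       [0, 6, 4, 2], [0, 7, 6, 1], [0, 8, 2, -1], [0, -1, 7, 6], [-1, 0, 6, 7]]"
    by code_simp
  from has_oa4_cyclic_base[OF this] show ?thesis by simp
qed

lemma has_oa4_14: "has_oa4 14"
proof -
  have "cyclic_base 13
      [[0, 0, 0, 0], [0, 1, -1, 2], [0, 2, 3, 6], [0, 3, 7, 12], [0, 4, 12, 10], [0, 5, 10, 3],
       [0, 6, 2, 11], [0, 7, 5, 9], [0, 8, 11, 5], [0, 9, 6, 8], [0, 10, 9, 4], [0, 11, 4, 1],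
       [0, 12, 1, -1], [0, -1, 8, 7], [-1, 0, 7, 8]]"
    by code_simp
  from has_oa4_cyclic_base[OF this] show ?thesis by simp
qed

lemma has_oa4_wilson:
  assumes "odd t" "\<not> 3 dvd t" "odd u" "u \<le> t"
  shows "has_oa4 (3 * t + u)"
proof -
  have "coprime d t" if "1 \<le> d" "d + 1 < Suc 4" for d
  proof -
    have "coprime 3 t" using assms(2) by (intro prime_imp_coprime) auto
    moreover have "d \<in> {1, 2, 3}" using that by auto
    ultimately show ?thesis using assms(1) by auto
  qed
  from orthogonal_array_linear[of t "Suc 4", OF _ this]
  have V: "orthogonal_array (Suc 4) {..<t} ({..<t} \<times> {..<t})
    (\<lambda>(x, y) i. if i = 0 then y else (x + i * y) mod t)"
    using assms(1) odd_pos by blast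
  obtain RA :: "(nat \<times> nat) set" and fA where "orthogonal_array 4 {..<3::nat} RA fA"
    using has_oa4_odd[of 3] unfolding has_oa4_def by auto
  moreover have "bij_betw int {..<3} {0..<3}"
    by (rule bij_betw_byWitness[of _ nat]) auto
  ultimately have A: "orthogonal_array 4 {0..<3::int} RA (\<lambda>r i. int (fA r i))"
    by (rule orthogonal_array_image)
  obtain RU :: "(nat \<times> nat) set" and fU where C: "orthogonal_array 4 {..<u} RU fU"
    using has_oa4_odd[of u] assms unfolding has_oa4_def by auto
  \<comment> \<open>The point at infinity plays the role of \<open>z\<close>, and
    \<open>None\<close> that of the constant row.\<close>
  have "{-1..<int 3} = insert (-1) {0..<3::int}" by auto
  with orthogonal_array_cyclic_base[OF cyclic_base_starter3]
  have B: "orthogonal_array 4 (insert (-1) {0..<3::int}) (insert None (Some ` ({0..<int 3} \<times> {..<3 + 2})))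
    (\<lambda>r i. case r of None \<Rightarrow> -1
       | Some (h, n) \<Rightarrow> if starter3 ! n ! i = -1 then -1 else (starter3 ! n ! i + h) mod int 3)"
    by simp
  show ?thesis
    by (rule has_oa4I[OF orthogonal_array_wilson[OF V _ _ A B _ _ _ C]])
      (use assms(4) in \<open>auto simp: card_Plus card_cartesian_product\<close>)
qed

lemma has_oa4:
  assumes "3 \<le> n" "n \<noteq> 6"
  shows "has_oa4 n"
proof (cases "odd n")
  case True then show ?thesis by (rule has_oa4_odd)
next
  case False
  \<comment> \<open>Here u = n - 3t is odd because \<open>n\<close> is even and \<open>t\<close>
    odd.\<close>
  have wilson: ?thesis if "odd t" "\<not> 3 dvd t" "3 * t < n" "n \<le> 4 * t" for t
    using has_oa4_wilson[of t "n - 3 * t"] that False by simp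
  have 4: "has_oa4 4" using has_oa4_cyclic_base[OF cyclic_base_starter3] by simp
  show ?thesis
  proof (cases "34 \<le> n")
    case True
    \<comment> \<open>On (18q, 18q + 18] the choices t = 6q - 1, 6q + 1 and 6q + 5 serve in turn.
      The first two need q \<ge> 2 for n \<le> 4t, which n \<ge> 34 ensures in their ranges.\<close>
    define q where "q = (n - 1) div 18"
    have q: "18 * q < n" "n \<le> 18 * q + 18" using True by (auto simp: q_def)
    consider "n \<le> 18 * q + 3" | "18 * q + 3 < n" "n \<le> 18 * q + 15" | "18 * q + 15 < n" by linarith
    then show ?thesis
    proof cases
      case 1
      with True obtain p where p: "q = Suc p" by (cases q) auto
      with 1 True have "1 \<le> p" by simp
      show ?thesis
      proof (rule wilson[of "6 * p + 5"])
        show "\<not> 3 dvd 6 * p + 5" by presburger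
      qed (use 1 p q \<open>1 \<le> p\<close> in simp_all)
    next
      case 2
      with True have "2 \<le> q" by linarith
      show ?thesis
      proof (rule wilson[of "6 * q + 1"])
        show "\<not> 3 dvd 6 * q + 1" by presburger
      qed (use 2 \<open>2 \<le> q\<close> in simp_all)
    next
      case 3
      show ?thesis
      proof (rule wilson[of "6 * q + 5"])
        show "\<not> 3 dvd 6 * q + 5" by presburger
      qed (use 3 q in simp_all)
    qed
  next
    case False
    \<comment> \<open>The two intervals are Wilson's construction with t = 5 and t = 7.\<close>
    with \<open>\<not> odd n\<close> assms
    have "n = 4 \<or> n = 8 \<or> n = 10 \<or> n = 12 \<or> n = 14 \<or> n = 30 \<or> n = 32 \<or>
      16 \<le> n \<and> n \<le> 20 \<or> 22 \<le> n \<and> n \<le> 28"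
      by presburger
    then show ?thesis
      using 4 has_oa4_8 has_oa4_10 has_oa4_14 has_oa4_product[of 3 4] has_oa4_product[of 3 10]
        has_oa4_product[of 4 8] has_oa4_odd[of 3] wilson[of 5] wilson[of 7]
      by (elim disjE) auto
  qed
qed

text \<open>This is a permutation matrix: the entries in columns \<open>p\<close> and
  \<open>q\<close> determine the row of the array, as do those in \<open>s\<close> and
  \<open>t\<close>.\<close>

lemma orthonormal_rows_incidence:
  assumes R: "orthogonal_array k {..<N} R f" and pq: "p < k" "q < k" "p \<noteq> q"
    and st: "s < k" "t < k" "s \<noteq> t"
  shows "orthonormal_rows N
    (\<lambda>i j a b. of_bool (\<exists>r\<in>R. f r p = i \<and> f r q = j \<and> f r s = a \<and> f r t = b))"
  unfolding orthonormal_rows_def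
proof (intro allI impI)
  fix i j k' l assume ijkl: "i < N" "j < N" "k' < N" "l < N"
  let ?M = "\<lambda>i j a b. of_bool (\<exists>r\<in>R. f r p = i \<and> f r q = j \<and> f r s = a \<and> f r t = b) :: complex"
  obtain r where r: "r \<in> R" "f r p = i" "f r q = j"
    using orthogonal_array_row[OF R pq, of i j] ijkl by auto
  obtain r' where r': "r' \<in> R" "f r' p = k'" "f r' q = l"
    using orthogonal_array_row[OF R pq, of k' l] ijkl by auto
  have M: "?M (f x p) (f x q) a b = of_bool (f x s = a \<and> f x t = b)" if x: "x \<in> R" for x a b
  proof -
    have "y = x" if "y \<in> R" "f y p = f x p" "f y q = f x q" for y
      using orthogonal_array_eq[OF R pq that(1) x that(2,3)] .
    then have "(\<exists>y\<in>R. f y p = f x p \<and> f y q = f x q \<and> f y s = a \<and> f y t = b) \<longleftrightarrow>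
        f x s = a \<and> f x t = b"
      using x by blast
    then show ?thesis by simp
  qed
  note Mr = M[OF r(1), unfolded r(2,3)] and Mr' = M[OF r'(1), unfolded r'(2,3)]
  have "2 \<le> k" using pq by linarith
  then have lt: "f r s < N" "f r t < N"
    using orthogonal_array_mem[OF R st(1) _ r(1)] orthogonal_array_mem[OF R st(2) _ r(1)] by auto
  have "r = r' \<longleftrightarrow> i = k' \<and> j = l"
    using orthogonal_array_eq[OF R pq r(1) r'(1)] r r' by auto
  moreover have "r = r' \<longleftrightarrow> f r' s = f r s \<and> f r' t = f r t"
    using orthogonal_array_eq[OF R st r(1) r'(1)] by auto
  moreover have "(\<Sum>a<N. \<Sum>b<N. ?M i j a b * cnj (?M k' l a b)) =
      (\<Sum>a<N. \<Sum>b<N. if b = f r t then (if a = f r s then of_bool (f r' s = a \<and> f r' t = b) else 0) else 0)"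
    unfolding Mr Mr' by (intro sum.cong refl) auto
  then have "(\<Sum>a<N. \<Sum>b<N. ?M i j a b * cnj (?M k' l a b)) = of_bool (f r' s = f r s \<and> f r' t = f r t)"
    using lt by simp
  ultimately show "(\<Sum>a<N. \<Sum>b<N. ?M i j a b * cnj (?M k' l a b)) = (if i = k' \<and> j = l then 1 else 0)"
    by simp
qed

text \<open>Realignment and partial transposition merely permute the roles of the four
  columns.\<close>

lemma multiunitary_of_has_oa4:
  assumes "has_oa4 N"
  shows "\<exists>M. multiunitary N M"
proof -
  obtain R :: "(nat \<times> nat) set" and f where R: "orthogonal_array 4 {..<N} R f"
    using assms unfolding has_oa4_def by blast
  let ?M = "\<lambda>i j a b. of_bool (\<exists>r\<in>R. f r 0 = i \<and> f r 1 = j \<and> f r 2 = a \<and> f r 3 = b) :: complex"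
  note rows = orthonormal_rows_incidence[OF R]
  have "multiunitary N ?M"
    unfolding multiunitary_def unitary_pair_iff_orthonormal_rows realign_def partial_transpose_def
    using rows[of 0 1 2 3] rows[of 2 3 0 1] rows[of 0 2 1 3] rows[of 1 3 0 2]
      rows[of 0 3 2 1] rows[of 2 1 0 3]
    by (simp add: conj_ac)
  then show ?thesis by blast
qed


section \<open>Order six\<close>

definition om :: complex where
  "om = Complex (- 1 / 2) (sqrt 3 / 2)"

text \<open>The pair (x, y) stands for the Eisenstein integer x + y om.\<close>
definition eis :: "int \<times> int \<Rightarrow> complex" where
  "eis z = of_int (fst z) + of_int (snd z) * om"

text \<open>Multiplied out using cnj om = om^2 = -1 - om.\<close>

definition eis_mult_cnj :: "int \<times> int \<Rightarrow> int \<times> int \<Rightarrow> int \<times> int" where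
  "eis_mult_cnj z w =
     (fst z * fst w - fst z * snd w + snd z * snd w, snd z * fst w - fst z * snd w)"

lemma eis_mult_cnj: "eis (eis_mult_cnj z w) = eis z * cnj (eis w)"
  by (simp add: eis_def eis_mult_cnj_def om_def complex_eq_iff field_simps)

lemma eis_add: "eis (z + w) = eis z + eis w"
  by (simp add: eis_def algebra_simps)

lemma eis_zero: "eis 0 = 0"
  by (simp add: eis_def)

lemma eis_sum: "eis (sum f A) = (\<Sum>x\<in>A. eis (f x))"
  by (induction A rule: infinite_finite_induct) (simp_all add: eis_add eis_zero)

text \<open>Arithmetic modulo 6 on representatives below 6, by cases so that only linear arithmetic
  remains.\<close>

definition add6 :: "nat \<Rightarrow> nat \<Rightarrow> nat" where
  "add6 a b = (if a + b < 6 then a + b else a + b - 6)"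

definition sub6 :: "nat \<Rightarrow> nat \<Rightarrow> nat" where
  "sub6 a b = (if b \<le> a then a - b else a + 6 - b)"

text \<open>With zeta = exp (i pi / 3), the entry corr p s is the sum of lambda p q zeta^(q s) over q < 6, for
  an array lambda of cube roots of unity found by computer search. As 1 / 6 times the sum of
  zeta^(q (a - c)) lambda (b - a) q is the ((a, b), (c, d)) entry, for d - c = b - a, of the matrix
  that is diagonal with eigenvalues lambda in the generalised Bell basis, unitarity is immediate;
  lambda was chosen such that its autocorrelations, plain and symplectically twisted, vanish, which
  makes the other two rearrangements unitary as well.\<close>
definition corr :: "nat \<Rightarrow> nat \<Rightarrow> int \<times> int" where
  "corr p s =
    [[(1, -1), (-1, 1), (4, 2), (-1, 1), (1, -1), (2, -2)],
     [(0, 0), (-3, 0), (-3, -3), (0, 0), (3, 0), (-3, -3)],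
     [(-2, -1), (2, -2), (1, 2), (2, 1), (4, 2), (-1, -2)],
     [(-3, -3), (-3, -3), (0, 0), (3, 3), (-3, -3), (0, 0)],
     [(-2, -4), (-1, -2), (1, -1), (-4, -2), (1, 2), (-1, 1)],
     [(0, 3), (0, 0), (3, 0), (0, 3), (0, 0), (-3, 0)]] ! p ! s"

text \<open>Row (i, j) of the matrix in question has the entries v i j a, in the columns (a, d i j a), and
  zeros elsewhere.\<close>
definition sparse_check :: "(nat \<Rightarrow> nat \<Rightarrow> nat \<Rightarrow> nat) \<Rightarrow> (nat \<Rightarrow> nat \<Rightarrow> nat \<Rightarrow> int \<times> int) \<Rightarrow> bool" where
  "sparse_check d v \<longleftrightarrow> (\<forall>i\<in>set [0..<6]. \<forall>j\<in>set [0..<6]. \<forall>k\<in>set [0..<6]. \<forall>l\<in>set [0..<6].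
     (\<Sum>a\<leftarrow>[0..<6]. if d i j a = d k l a then eis_mult_cnj (v i j a) (v k l a) else 0) =
     (if i = k \<and> j = l then (36, 0) else (0, 0)))"

text \<open>Rows (i, j) and (k, l) overlap only at those \<open>a\<close> where their supports
  agree. The two factors 1/6 explain the norm 36 in the check.\<close>

lemma sparse_check_imp:
  assumes chk: "sparse_check d v"
    and d: "\<And>i j a. i < 6 \<Longrightarrow> j < 6 \<Longrightarrow> a < 6 \<Longrightarrow> d i j a < 6"
    and M: "\<And>i j a b. i < 6 \<Longrightarrow> j < 6 \<Longrightarrow> a < 6 \<Longrightarrow> b < 6 \<Longrightarrow>
       M i j a b = (if b = d i j a then eis (v i j a) / 6 else 0)"
  shows "orthonormal_rows 6 M"
  unfolding orthonormal_rows_def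
proof (intro allI impI)
  fix i j k l :: nat assume ijkl: "i < 6" "j < 6" "k < 6" "l < 6"
  have "(\<Sum>a<6. \<Sum>b<6. M i j a b * cnj (M k l a b)) =
    (\<Sum>a<6. \<Sum>b<6. if b = d i j a then (if d i j a = d k l a then eis (v i j a) * cnj (eis (v k l a)) / 36 else 0) else 0)"
    by (intro sum.cong refl) (use ijkl in \<open>auto simp: M\<close>)
  also have "\<dots> = (\<Sum>a<6. if d i j a = d k l a then eis (v i j a) * cnj (eis (v k l a)) / 36 else 0)"
    by (intro sum.cong refl) (use ijkl d in \<open>simp add: sum.delta\<close>)
  also have "\<dots> = (\<Sum>a<6. eis (if d i j a = d k l a then eis_mult_cnj (v i j a) (v k l a) else 0)) / 36"
    unfolding sum_divide_distrib by (intro sum.cong) (auto simp: eis_mult_cnj eis_zero)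
  also have "\<dots> = eis (\<Sum>a\<leftarrow>[0..<6]. if d i j a = d k l a then eis_mult_cnj (v i j a) (v k l a) else 0) / 36"
    unfolding interv_sum_list_conv_sum_set_nat by (simp only: eis_sum set_upt atLeast0LessThan)
  also have "(\<Sum>a\<leftarrow>[0..<6]. if d i j a = d k l a then eis_mult_cnj (v i j a) (v k l a) else 0) =
      (if i = k \<and> j = l then (36, 0) else (0, 0))"
    using chk ijkl unfolding sparse_check_def set_upt atLeast0LessThan by blast
  finally show "(\<Sum>a<6. \<Sum>b<6. M i j a b * cnj (M k l a b)) = (if i = k \<and> j = l then 1 else 0)"
    by (auto simp: eis_def split: if_splits)
qed

text \<open>The support is a + d = b + c modulo 6, so any three indices determine the fourth and
  every rearrangement is equally sparse.\<close>

definition ame6 :: "nat \<Rightarrow> nat \<Rightarrow> nat \<Rightarrow> nat \<Rightarrow> complex" where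
  "ame6 a b c d = (if d = sub6 (add6 b c) a then eis (corr (sub6 b a) (sub6 a c)) / 6 else 0)"

text \<open>Allows the support condition to be solved for whichever index comes last in a
  rearrangement.\<close>

lemma ame6_eqI:
  assumes "P \<longleftrightarrow> d = sub6 (add6 b c) a" and "P \<Longrightarrow> sub6 b a = p \<and> sub6 a c = s"
  shows "ame6 a b c d = (if P then eis (corr p s) / 6 else 0)"
  using assms by (auto simp: ame6_def)

text \<open>The six checks come in pairs, rows then columns: for \<open>ame6\<close>, its
  realignment and its partial transpose.\<close>

lemma sparse_check_ame6_1:
  "sparse_check (\<lambda>i j a. sub6 (add6 j a) i) (\<lambda>i j a. corr (sub6 j i) (sub6 i a))"
  by code_simp

lemma sparse_check_ame6_2:
  "sparse_check (\<lambda>i j a. sub6 (add6 j a) i) (\<lambda>i j a. corr (sub6 j i) (sub6 a i))"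
  by code_simp

lemma sparse_check_ame6_3:
  "sparse_check (\<lambda>i j a. sub6 (add6 j a) i) (\<lambda>i j a. corr (sub6 a i) (sub6 i j))"
  by code_simp

lemma sparse_check_ame6_4:
  "sparse_check (\<lambda>i j a. sub6 (add6 j a) i) (\<lambda>i j a. corr (sub6 i a) (sub6 i j))"
  by code_simp

lemma sparse_check_ame6_5:
  "sparse_check (\<lambda>i j a. sub6 (add6 j i) a) (\<lambda>i j a. corr (sub6 j a) (sub6 i a))"
  by code_simp

lemma sparse_check_ame6_6:
  "sparse_check (\<lambda>i j a. sub6 (add6 j i) a) (\<lambda>i j a. corr (sub6 j a) (sub6 a i))"
  by code_simp

lemma multiunitary_ame6: "multiunitary 6 ame6"
proof -
  have "orthonormal_rows 6 ame6"
    by (rule sparse_check_imp[OF sparse_check_ame6_1])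
      (auto simp: ame6_def sub6_def add6_def)
  moreover have "orthonormal_rows 6 (\<lambda>i j a b. ame6 a b i j)"
    by (rule sparse_check_imp[OF sparse_check_ame6_2])
      (force simp: sub6_def add6_def, rule ame6_eqI,
        auto simp: sub6_def add6_def split: if_splits)
  moreover have "orthonormal_rows 6 (\<lambda>i j a b. ame6 i a j b)"
    by (rule sparse_check_imp[OF sparse_check_ame6_3])
      (force simp: sub6_def add6_def, rule ame6_eqI,
        auto simp: sub6_def add6_def split: if_splits)
  moreover have "orthonormal_rows 6 (\<lambda>i j a b. ame6 a i b j)"
    by (rule sparse_check_imp[OF sparse_check_ame6_4])
      (force simp: sub6_def add6_def, rule ame6_eqI,
        auto simp: sub6_def add6_def split: if_splits)
  moreover have "orthonormal_rows 6 (\<lambda>i j a b. ame6 i b a j)"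
    by (rule sparse_check_imp[OF sparse_check_ame6_5])
      (force simp: sub6_def add6_def, rule ame6_eqI,
        auto simp: sub6_def add6_def split: if_splits)
  moreover have "orthonormal_rows 6 (\<lambda>i j a b. ame6 a j i b)"
    by (rule sparse_check_imp[OF sparse_check_ame6_6])
      (force simp: sub6_def add6_def, rule ame6_eqI,
        auto simp: sub6_def add6_def split: if_splits)
  ultimately show ?thesis
    unfolding multiunitary_def unitary_pair_iff_orthonormal_rows realign_def partial_transpose_def by simp
qed

theorem mainTheorem15:
  shows "(\<exists>Q. OQLS 6 Q) \<and> (\<exists>\<psi>. AME4 6 \<psi>) \<and> (\<exists>M. multiunitary 6 M) \<and>
         (\<forall>N::nat. N \<ge> 3 \<longrightarrow> (\<exists>Q. OQLS N Q) \<and> (\<exists>\<psi>. AME4 N \<psi>))"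
proof -
  \<comment> \<open>Order 6 is supplied by \<open>ame6\<close>, every other order by a permutation
    matrix.\<close>
  have M: "\<exists>M. multiunitary N M" if "3 \<le> N" for N
    using that multiunitary_ame6 multiunitary_of_has_oa4[OF has_oa4] by (cases "N = 6") auto
  have "(\<exists>Q. OQLS N Q) \<and> (\<exists>\<psi>. AME4 N \<psi>)" if N: "3 \<le> N" for N
  proof -
    obtain M where M': "multiunitary N M" using M[OF N] by blast
    have "AME4 N (\<lambda>a b c d. M a b c d / of_nat N)"
      using N by (intro AME4_of_multiunitary[OF M']) simp
    with OQLS_of_multiunitary[OF M'] show ?thesis by blast
  qed
  with M show ?thesis by simp
qed

end
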